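(* Let $A, X \in \mathbb{C}^{m \times n}$, $W \in \mathbb{C}^{n \times m}$ and $k= \mathrm{ind}(A,W)$. Then (i) $X \in A\{1',2',3', {1^{k}}'\}$ if and only if $XWAWX=X$, $r(WAW)=r(A)$, $\mathcal{N}(X)=\mathcal{N}((WA)^* )$ and $\mathcal{R}(X) \supseteq \mathcal{R}((AW)^k)$; (ii) $X \in A\{1',2',3', {1^{k}}'\}$ if and only if $AWXWA=A$, $r(WAW)=r(A)$, $\mathcal{N}(X)=\mathcal{N}((WA)^* )$ and $\mathcal{R}(X) \supseteq \mathcal{R}((AW)^k)$.
   Context: $r(\cdot)$, $\mathcal{R}(\cdot)$, $\mathcal{N}(\cdot)$ denote rank, range and null space; $*$ is conjugate transpose. The index $\mathrm{ind}(M)$ of a square matrix $M$ is the smallest non-negative integer $j$ with $r(M^j)=r(M^{j+1})$ (with $M^0=I$); $\mathrm{ind}(A,W)=\max\{\mathrm{ind}(AW),\mathrm{ind}(WA)\}$. $A\{1',2',3',{1^k}'\}$ is the set of all $X\in\mathbb{C}^{m\times n}$ with $AWXWA=A$, $XWAWX=X$, $(WAWX)^*=WAWX$ and $XW(AW)^{k+1}=(AW)^k$. *)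

theory Defs
  imports "HOL-Analysis.Analysis"
begin

text \<open>
  A complex \<open>m \<times> n\<close> matrix has type \<open>complex^'n^'m\<close>, with \<open>m = CARD('m)\<close> and \<open>n = CARD('n)\<close>.
  The rank is the library's \<open>rank\<close>, which for complex matrices is the rank over the complex field.
\<close>

definition cadjoint :: "complex^'n^'m \<Rightarrow> complex^'m^'n" where
  "cadjoint A = (\<chi> i j. cnj (A $ j $ i))"

definition mat_range :: "complex^'n^'m \<Rightarrow> (complex^'m) set" where
  "mat_range A = range (\<lambda>x. A *v x)"

definition mat_null :: "complex^'n^'m \<Rightarrow> (complex^'n) set" where
  "mat_null A = {x. A *v x = 0}"

text \<open>
  The power operator \<open>^\<close> would act componentwise on the vector type, so powers with respect to
  the matrix product are defined separately.
\<close>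

primrec mat_power :: "complex^'n^'n \<Rightarrow> nat \<Rightarrow> complex^'n^'n" where
  "mat_power M 0 = mat 1"
| "mat_power M (Suc j) = M ** mat_power M j"

definition mat_index :: "complex^'n^'n \<Rightarrow> nat" where
  "mat_index M = (LEAST j. rank (mat_power M j) = rank (mat_power M (j + 1)))"

lemma rank_mult_le_right:
  fixes A :: "'a::field^'n^'m" and B :: "'a^'p^'n"
  shows "rank (A ** B) \<le> rank B"
proof -
  have "row i (A ** B) \<in> vec.span (rows B)" for i
  proof -
    have "row i (A ** B) = (\<Sum>l\<in>UNIV. A $ i $ l *s row l B)"
      by (simp add: vec_eq_iff row_def matrix_matrix_mult_def)
    also have "\<dots> \<in> vec.span (rows B)"
      by (intro vec.span_sum vec.span_scale vec.span_base) (auto simp: rows_def)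
    finally show ?thesis .
  qed
  then show ?thesis
    unfolding row_rank_def_gen by (intro vec.dim_mono) (auto simp: rows_def)
qed

text \<open>
  The next lemma shows that the \<open>LEAST\<close> above is taken over a nonempty set.
\<close>

lemma mat_index_exists: "\<exists>j. rank (mat_power M j) = rank (mat_power M (j + 1))"
proof (rule ccontr)
  assume "\<not> ?thesis"
  moreover have "rank (mat_power M (j + 1)) \<le> rank (mat_power M j)" for j
    by (simp add: rank_mult_le_right)
  ultimately have less: "rank (mat_power M (j + 1)) < rank (mat_power M j)" for j
    by (metis le_neq_implies_less)
  have "rank (mat_power M j) + j \<le> rank (mat_power M 0)" for j
  proof (induction j)
    case (Suc j)
    then show ?case using less[of j] by simp
  qed simp
  from this[of "Suc (rank (mat_power M 0))"] show False by simp
qed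

definition weighted_index :: "complex^'n^'m \<Rightarrow> complex^'m^'n \<Rightarrow> nat" where
  "weighted_index A W = max (mat_index (A ** W)) (mat_index (W ** A))"

text \<open>
  The set \<open>A{1', 2', 3', 1\<^sup>k'}\<close> of generalized inverses of \<open>A\<close> with respect to the weight \<open>W\<close>.
\<close>

definition weighted_inverses ::
    "complex^'n^'m \<Rightarrow> complex^'m^'n \<Rightarrow> nat \<Rightarrow> (complex^'n^'m) set" where
  "weighted_inverses A W k =
    {X. A ** W ** X ** W ** A = A \<and>
        X ** W ** A ** W ** X = X \<and>
        cadjoint (W ** A ** W ** X) = W ** A ** W ** X \<and>
        X ** W ** mat_power (A ** W) (k + 1) = mat_power (A ** W) k}"

end

theory Submission
  imports Defs
begin

text \<open>
  Conditions on ranks, ranges and null spaces turn into one-sided matrix factorizations, by means of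
  a \<open>G\<close> with \<open>A G A = A\<close>. In particular, the condition on null spaces says that
  \<open>X = C (W A)\<^sup>*\<close> and \<open>(W A)\<^sup>* = D X\<close> for some \<open>C\<close> and \<open>D\<close>. Put \<open>P = W A W X\<close>. If \<open>X P = X\<close>, then
  \<open>(W A)\<^sup>* P = (W A)\<^sup>*\<close>, so \<open>P\<^sup>* P = P\<^sup>*\<close> and \<open>P\<close> is Hermitian; hence \<open>P W A = W A\<close>, and
  \<open>r (W A) = r A\<close> lets one cancel \<open>W\<close>. If instead \<open>P W A = W A\<close>, then \<open>X P\<^sup>* = X\<close>, so \<open>P P\<^sup>* = P\<close>, and
  again \<open>P\<close> is Hermitian and \<open>X P = X\<close>.
\<close>

text \<open>A linear map picks a preimage of each vector in the range of \<open>A\<close>; its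
  matrix is \<open>G\<close>.\<close>

lemma generalized_inverse_exists:
  fixes A :: "'a::field^'n^'m"
  obtains G :: "'a^'m^'n" where "A ** G ** A = A"
proof -
  obtain g where g: "Vector_Spaces.linear (*s) (*s) g" "\<forall>v\<in>range ((*v) A). A *v g v = v"
    using vec.linear_exists_right_inverse_on[OF matrix_vector_mul_linear_gen[of A] vec.subspace_UNIV]
    by auto
  have "A ** matrix g ** A = A"
    using g by (simp add: matrix_eq matrix_works flip: matrix_vector_mul_assoc)
  then show ?thesis by (rule that)
qed

text \<open>\<open>B ** G\<close> fixes the range of \<open>B\<close>, so \<open>C = G ** A\<close>
  will do.\<close>

lemma range_subset_imp_factor:
  fixes A :: "'a::field^'n^'m" and B :: "'a^'p^'m"
  assumes "range ((*v) A) \<subseteq> range ((*v) B)"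
  obtains C where "A = B ** C"
proof -
  obtain G where G: "B ** G ** B = B" by (rule generalized_inverse_exists)
  have "(B ** G ** A) *v x = A *v x" for x
  proof -
    obtain y where y: "A *v x = B *v y" using assms by blast
    have "(B ** G ** A) *v x = (B ** G ** B) *v y"
      using y by (simp flip: matrix_vector_mul_assoc)
    then show ?thesis using G y by simp
  qed
  then have "A = B ** (G ** A)" by (simp add: matrix_eq matrix_mul_assoc)
  then show ?thesis by (rule that)
qed

text \<open>\<open>x - G *v (A *v x)\<close> lies in the null space of \<open>A\<close>, so
  \<open>B\<close> kills it; hence \<open>C = B ** G\<close> will do.\<close>

lemma null_subset_imp_factor:
  fixes A :: "'a::field^'n^'m" and B :: "'a^'n^'p"
  assumes "\<And>x. A *v x = 0 \<Longrightarrow> B *v x = 0"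
  obtains C where "B = C ** A"
proof -
  obtain G where G: "A ** G ** A = A" by (rule generalized_inverse_exists)
  have "B *v x = (B ** G ** A) *v x" for x
  proof -
    have "A *v (x - G *v (A *v x)) = 0"
      using G by (simp add: matrix_vector_mult_diff_distrib matrix_vector_mul_assoc matrix_mul_assoc)
    then have "B *v (x - G *v (A *v x)) = 0" by (rule assms)
    then show ?thesis
      by (simp add: matrix_vector_mult_diff_distrib matrix_vector_mul_assoc matrix_mul_assoc)
  qed
  then have "B = (B ** G) ** A" by (simp add: matrix_eq)
  then show ?thesis by (rule that)
qed

text \<open>The rows of the product are the images of the rows of \<open>A\<close> under
  \<open>transpose B\<close>, and a linear map does not raise dimension.\<close>

lemma rank_mult_le_left:
  fixes A :: "'a::field^'n^'m" and B :: "'a^'p^'n"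
  shows "rank (A ** B) \<le> rank A"
proof -
  have "row i (A ** B) = transpose B *v row i A" for i
    by (simp add: vec_eq_iff row_def transpose_def matrix_matrix_mult_def
        matrix_vector_mult_def mult.commute)
  then have "rows (A ** B) = (*v) (transpose B) ` rows A"
    by (auto simp: rows_def)
  then show ?thesis
    unfolding row_rank_def_gen
    by (simp only: vec.dim_image_le[OF matrix_vector_mul_linear_gen])
qed

text \<open>The pairing is bilinear, without conjugation: for fixed \<open>x\<close> it is linear in
  \<open>r\<close> and vanishes on each row because \<open>M *v x = 0\<close>.\<close>

lemma rows_span_null:
  fixes M :: "'a::field^'n^'m"
  assumes "M *v x = 0" "r \<in> vec.span (rows M)"
  shows "(\<Sum>j\<in>UNIV. r $ j * x $ j) = 0"
  using assms(2)
proof (induction rule: vec.span_induct_alt)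
  case base
  then show ?case by simp
next
  case (step c r s)
  then obtain i where "r = row i M" by (auto simp: rows_def)
  then have "(\<Sum>j\<in>UNIV. r $ j * x $ j) = (M *v x) $ i"
    by (simp add: row_def matrix_vector_mult_def)
  then show ?case
    using step assms(1)
    by (simp add: algebra_simps sum.distrib flip: sum_distrib_left)
qed

text \<open>Equal ranks force the row spaces of \<open>B ** A\<close> and \<open>A\<close> to
  coincide, so whatever \<open>B ** A\<close> kills is killed by \<open>A\<close>.\<close>

lemma rank_mult_eq_imp_factor:
  fixes A :: "'a::field^'n^'m" and B :: "'a^'m^'p"
  assumes "rank (B ** A) = rank A"
  obtains C where "A = C ** (B ** A)"
proof -
  have "row i (B ** A) \<in> vec.span (rows A)" for i
  proof -
    have "row i (B ** A) = (\<Sum>l\<in>UNIV. B $ i $ l *s row l A)"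
      by (simp add: vec_eq_iff row_def matrix_matrix_mult_def)
    also have "\<dots> \<in> vec.span (rows A)"
      by (intro vec.span_sum vec.span_scale vec.span_base) (auto simp: rows_def)
    finally show ?thesis .
  qed
  then have sub: "vec.span (rows (B ** A)) \<subseteq> vec.span (rows A)"
    by (intro vec.span_minimal vec.subspace_span) (auto simp: rows_def)
  then have span: "vec.span (rows (B ** A)) = vec.span (rows A)"
    using assms by (intro vec.subspace_dim_equal vec.subspace_span)
      (simp_all add: row_rank_def_gen)
  have "A *v x = 0" if "(B ** A) *v x = 0" for x
  proof -
    have "(A *v x) $ i = 0" for i
    proof -
      have "row i A \<in> vec.span (rows (B ** A))"
        unfolding span by (rule vec.span_base) (auto simp: rows_def)
      from rows_span_null[OF that this] show ?thesis
        by (simp add: row_def matrix_vector_mult_def)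
    qed
    then show ?thesis by (simp add: vec_eq_iff)
  qed
  then obtain C where "A = C ** (B ** A)" by (rule null_subset_imp_factor)
  then show ?thesis by (rule that)
qed

lemma cadjoint_mult: "cadjoint (A ** B) = cadjoint B ** cadjoint A"
  by (simp add: cadjoint_def vec_eq_iff matrix_matrix_mult_def mult.commute)

lemma cadjoint_cadjoint [simp]: "cadjoint (cadjoint A) = A"
  by (simp add: cadjoint_def vec_eq_iff)

lemma mat_null_eq_imp_factor:
  fixes A :: "complex^'n^'m" and B :: "complex^'n^'p"
  assumes "mat_null A = mat_null B"
  obtains C where "A = C ** B"
proof -
  have "A *v x = 0" if "B *v x = 0" for x
    using assms that by (auto simp: mat_null_def)
  then obtain C where "A = C ** B" by (rule null_subset_imp_factor)
  then show ?thesis by (rule that)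
qed

lemma mat_null_subset_mult: "mat_null A \<subseteq> mat_null (C ** A)"
  by (auto simp: mat_null_def simp flip: matrix_vector_mul_assoc)

lemma mat_range_mult_subset: "mat_range (A ** C) \<subseteq> mat_range A"
  by (auto simp: mat_range_def simp flip: matrix_vector_mul_assoc)

text \<open>\<open>B\<close> plays the role of \<open>W A\<close>, and \<open>B Y\<close> with \<open>Y = W X\<close> that of the projector \<open>P\<close>.\<close>

lemma hermitian_of_outer:
  assumes X: "X ** (B ** Y) = X" and null: "mat_null X = mat_null (cadjoint B)"
  shows "cadjoint (B ** Y) = B ** Y" "B ** Y ** B = B"
proof -
  let ?P = "B ** Y"
  obtain D where "cadjoint B = D ** X"
    using null by (metis mat_null_eq_imp_factor)
  then have B: "cadjoint B ** ?P = cadjoint B"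
    using X by (metis matrix_mul_assoc)
  then have "cadjoint ?P ** ?P = cadjoint ?P"
    by (metis cadjoint_mult matrix_mul_assoc)
  \<comment> \<open>\<open>cadjoint ?P ** ?P\<close> is its own adjoint, so the last equation makes
    \<open>cadjoint ?P\<close> Hermitian.\<close>
  then show herm: "cadjoint ?P = ?P"
    by (metis cadjoint_mult cadjoint_cadjoint)
  show "?P ** B = B"
    using B herm by (metis cadjoint_mult cadjoint_cadjoint)
qed

lemma hermitian_of_inner:
  assumes B: "B ** Y ** B = B" and null: "mat_null X = mat_null (cadjoint B)"
    and Y: "Y = W ** X"
  shows "cadjoint (B ** Y) = B ** Y" "X ** (B ** Y) = X"
proof -
  let ?P = "B ** Y"
  obtain C where "X = C ** cadjoint B"
    using null by (metis mat_null_eq_imp_factor)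
  moreover have "cadjoint B ** cadjoint ?P = cadjoint B"
    using B by (metis cadjoint_mult)
  ultimately have X: "X ** cadjoint ?P = X"
    by (metis matrix_mul_assoc)
  \<comment> \<open>Multiply on the left by \<open>B ** W\<close>, which turns \<open>X\<close> into
    \<open>?P\<close>.\<close>
  then have "?P ** cadjoint ?P = ?P"
    unfolding Y by (metis matrix_mul_assoc)
  then show herm: "cadjoint ?P = ?P"
    by (metis cadjoint_mult cadjoint_cadjoint)
  show "X ** ?P = X"
    using X herm by simp
qed

text \<open>Moving the Hermitian projector across an adjoint writes \<open>X\<close> as a left
  multiple of \<open>cadjoint B\<close>, and \<open>cadjoint B\<close> as one of
  \<open>X\<close>.\<close>

lemma mat_null_eq_of_hermitian:
  assumes B: "B ** (W ** X) ** B = B" and X: "X ** (B ** (W ** X)) = X"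
    and herm: "cadjoint (B ** (W ** X)) = B ** (W ** X)"
  shows "mat_null X = mat_null (cadjoint B)"
proof
  have "X = X ** cadjoint (W ** X) ** cadjoint B"
    using X herm by (metis cadjoint_mult matrix_mul_assoc)
  then show "mat_null (cadjoint B) \<subseteq> mat_null X"
    by (metis mat_null_subset_mult)
  have "cadjoint B = cadjoint B ** B ** W ** X"
    using B herm by (metis cadjoint_mult matrix_mul_assoc)
  then show "mat_null X \<subseteq> mat_null (cadjoint B)"
    by (metis mat_null_subset_mult)
qed

lemma rank_weighted_eq:
  fixes A X :: "complex^'n^'m" and W :: "complex^'m^'n"
  assumes A: "A ** W ** X ** W ** A = A" and X: "X ** W ** A ** W ** X = X"
  shows "rank (W ** A ** W) = rank A"
proof (rule antisym)
  show "rank (W ** A ** W) \<le> rank A"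
    by (meson order_trans rank_mult_le_left rank_mult_le_right)
  \<comment> \<open>Replace the \<open>X\<close> in \<open>A W X W A\<close> by
    \<open>X W A W X\<close>, so that \<open>W A W\<close> appears as a factor of
    \<open>A\<close>.\<close>
  have "A = (A ** W ** X) ** ((W ** A ** W) ** (X ** W ** A))"
    using A X by (simp add: matrix_mul_assoc)
  then show "rank A \<le> rank (W ** A ** W)"
    by (metis order_trans rank_mult_le_left rank_mult_le_right)
qed

text \<open>The power is \<open>X ** Z\<close> for some \<open>Z\<close>, and \<open>X W A W\<close>
  acts as the identity on the range of \<open>X\<close>.\<close>

lemma mat_range_superset_imp_outer:
  assumes X: "X ** W ** A ** W ** X = X"
    and sub: "mat_range (mat_power (A ** W) k) \<subseteq> mat_range X"
  shows "X ** W ** mat_power (A ** W) (k + 1) = mat_power (A ** W) k"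
proof -
  obtain Z where Z: "mat_power (A ** W) k = X ** Z"
    using sub range_subset_imp_factor unfolding mat_range_def by metis
  have "X ** W ** mat_power (A ** W) (k + 1) = X ** W ** A ** W ** X ** Z"
    by (simp add: Z matrix_mul_assoc)
  then show ?thesis by (simp add: X Z)
qed

lemma weighted_inverses_imp:
  fixes A X :: "complex^'n^'m" and W :: "complex^'m^'n"
  assumes "X \<in> weighted_inverses A W k"
  shows "A ** W ** X ** W ** A = A" "X ** W ** A ** W ** X = X"
    "rank (W ** A ** W) = rank A" "mat_null X = mat_null (cadjoint (W ** A))"
    "mat_range (mat_power (A ** W) k) \<subseteq> mat_range X"
proof -
  from assms show A: "A ** W ** X ** W ** A = A" and X: "X ** W ** A ** W ** X = X"
    by (auto simp: weighted_inverses_def)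
  then show "rank (W ** A ** W) = rank A" by (rule rank_weighted_eq)
  have pow: "X ** W ** mat_power (A ** W) (k + 1) = mat_power (A ** W) k"
    and herm: "cadjoint (W ** A ** W ** X) = W ** A ** W ** X"
    using assms by (auto simp: weighted_inverses_def)
  show "mat_null X = mat_null (cadjoint (W ** A))"
  proof (rule mat_null_eq_of_hermitian)
    show "W ** A ** (W ** X) ** (W ** A) = W ** A"
      using A by (metis matrix_mul_assoc)
    show "X ** (W ** A ** (W ** X)) = X"
      using X by (simp add: matrix_mul_assoc)
    show "cadjoint (W ** A ** (W ** X)) = W ** A ** (W ** X)"
      using herm by (simp add: matrix_mul_assoc)
  qed
  show "mat_range (mat_power (A ** W) k) \<subseteq> mat_range X"
    using pow by (metis mat_range_mult_subset matrix_mul_assoc)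
qed

lemma weighted_inverses_of_outer:
  fixes A X :: "complex^'n^'m" and W :: "complex^'m^'n"
  assumes X: "X ** W ** A ** W ** X = X" and rank: "rank (W ** A ** W) = rank A"
    and null: "mat_null X = mat_null (cadjoint (W ** A))"
    and range: "mat_range (mat_power (A ** W) k) \<subseteq> mat_range X"
  shows "X \<in> weighted_inverses A W k"
proof -
  have "X ** (W ** A ** (W ** X)) = X"
    using X by (simp add: matrix_mul_assoc)
  note * = hermitian_of_outer[OF this null]
  \<comment> \<open>This rank lies between those of \<open>W A W\<close> and
    \<open>A\<close>.\<close>
  have "rank (W ** A) = rank A"
    using rank by (metis antisym rank_mult_le_left rank_mult_le_right)
  then obtain E where E: "A = E ** (W ** A)"
    by (rule rank_mult_eq_imp_factor)
  \<comment> \<open>\<open>E\<close> undoes the left factor \<open>W\<close>, bringing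
    \<open>P W A = W A\<close> back to an equation for \<open>A\<close>.\<close>
  have "A ** W ** X ** W ** A = E ** (W ** A ** (W ** X) ** (W ** A))"
    by (subst E) (simp add: matrix_mul_assoc)
  also have "\<dots> = A"
    using *(2) E by simp
  finally show ?thesis
    using X *(1) mat_range_superset_imp_outer[OF X range]
    by (simp add: weighted_inverses_def matrix_mul_assoc)
qed

lemma weighted_inverses_of_inner:
  fixes A X :: "complex^'n^'m" and W :: "complex^'m^'n"
  assumes A: "A ** W ** X ** W ** A = A"
    and null: "mat_null X = mat_null (cadjoint (W ** A))"
    and range: "mat_range (mat_power (A ** W) k) \<subseteq> mat_range X"
  shows "X \<in> weighted_inverses A W k"
proof -
  have "W ** A ** (W ** X) ** (W ** A) = W ** A"
    using A by (metis matrix_mul_assoc)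
  note * = hermitian_of_inner[OF this null refl]
  have X: "X ** W ** A ** W ** X = X"
    using *(2) by (simp add: matrix_mul_assoc)
  then show ?thesis
    using A *(1) mat_range_superset_imp_outer[OF X range]
    by (simp add: weighted_inverses_def matrix_mul_assoc)
qed

theorem theorem4p5:
  fixes A X :: "complex^'n^'m" and W :: "complex^'m^'n" and k :: nat
  assumes "k = weighted_index A W"
  shows "(X \<in> weighted_inverses A W k \<longleftrightarrow>
      X ** W ** A ** W ** X = X \<and> rank (W ** A ** W) = rank A \<and>
      mat_null X = mat_null (cadjoint (W ** A)) \<and>
      mat_range X \<supseteq> mat_range (mat_power (A ** W) k)) \<and>
    (X \<in> weighted_inverses A W k \<longleftrightarrow>
      A ** W ** X ** W ** A = A \<and> rank (W ** A ** W) = rank A \<and>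
      mat_null X = mat_null (cadjoint (W ** A)) \<and>
      mat_range X \<supseteq> mat_range (mat_power (A ** W) k))"
  using weighted_inverses_imp[of X A W k] weighted_inverses_of_outer[of X W A k]
    weighted_inverses_of_inner[of A W X k]
  by blast

end
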